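(* Let $r\ge1$, $J\ge r+1$, and let $H_J$ be an exact (deterministic, complex) $J\times J$ Hankel matrix of rank $r$, with $$s_*=\sigma_r(H_J)>0 .$$ Suppose $$\widehat H_J=H_J+B_J+Z_J,\qquad \mathbb{E}\|Z_J\|_F^2=\mathcal V_J,$$ where $B_J$ is a deterministic and $Z_J$ a random $J\times J$ complex matrix, and let $t>0$. If $$\|B_J\|_2+t<\tfrac12 s_*,$$ then, with probability at least $1-\mathcal V_J/t^2$, the threshold rank of $\widehat H_J$ is $r$ for every absolute threshold $\tau_{\rm abs}$ satisfying $$\|B_J\|_2+t<\tau_{\rm abs}<s_*-\|B_J\|_2-t .$$
   Context: $\sigma_1\ge\sigma_2\ge\cdots$ denote singular values, $\|\cdot\|_2$ the spectral norm and $\|\cdot\|_F$ the Frobenius norm. The threshold rank of a matrix at the absolute threshold $\tau_{\rm abs}$ is the number of its singular values that exceed $\tau_{\rm abs}$. $B_J$ represents deterministic (model and discretization) error and $Z_J$ stochastic error. *)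

theory Defs
  imports
    "HOL-Probability.Probability"
    "HOL-Computational_Algebra.Fundamental_Theorem_Algebra"
    "Jordan_Normal_Form.Schur_Decomposition"
    "Jordan_Normal_Form.DL_Rank"
begin

unbundle no vec_syntax

hide_const (open) Finite_Cartesian_Product.vec Finite_Cartesian_Product.mat
hide_type (open) Finite_Cartesian_Product.vec

definition hankel_mat :: "'a mat \<Rightarrow> bool" where
  "hankel_mat A \<longleftrightarrow> (\<exists>h :: nat \<Rightarrow> 'a. A = mat (dim_row A) (dim_col A) (\<lambda>(i, j). h (i + j)))"

(* Square roots of the eigenvalues of A^* A, repeated according to algebraic multiplicity and
   listed in decreasing order.  The eigenvalues are real and nonnegative, so Re only changes
   their type. *)
definition singular_values :: "complex mat \<Rightarrow> real list" where
  "singular_values A =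
     rev (sorted_list_of_multiset
       (image_mset (\<lambda>z. sqrt (Re z)) (proots (char_poly (mat_adjoint A * A)))))"

(* Numbered from 1, so the argument k is meaningful for 1 \<le> k \<le> dim_col A. *)
definition singular_value :: "complex mat \<Rightarrow> nat \<Rightarrow> real" where
  "singular_value A k = singular_values A ! (k - 1)"

definition threshold_rank :: "real \<Rightarrow> complex mat \<Rightarrow> nat" where
  "threshold_rank \<tau> A = length (filter (\<lambda>\<sigma>. \<tau> < \<sigma>) (singular_values A))"

definition l2_norm_vec :: "complex vec \<Rightarrow> real" where
  "l2_norm_vec v = sqrt (\<Sum>i<dim_vec v. (cmod (v $ i))\<^sup>2)"

definition spectral_norm :: "complex mat \<Rightarrow> real" where
  "spectral_norm A =
     (SUP v\<in>{v \<in> carrier_vec (dim_col A). l2_norm_vec v \<le> 1}. l2_norm_vec (A *\<^sub>v v))"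

definition frobenius_norm :: "complex mat \<Rightarrow> real" where
  "frobenius_norm A = sqrt (\<Sum>i<dim_row A. \<Sum>j<dim_col A. (cmod (A $$ (i, j)))\<^sup>2)"

(* The type of matrices carries no sigma-algebra; measurability is required entrywise. *)
definition random_mat :: "'w measure \<Rightarrow> nat \<Rightarrow> nat \<Rightarrow> ('w \<Rightarrow> complex mat) \<Rightarrow> bool" where
  "random_mat M m n X \<longleftrightarrow>
     (\<forall>\<omega>\<in>space M. X \<omega> \<in> carrier_mat m n) \<and>
     (\<forall>i<m. \<forall>j<n. (\<lambda>\<omega>. X \<omega> $$ (i, j)) \<in> borel_measurable M)"

end

theory Submission
  imports Defs
begin

text \<open>
  On the event \<open>\<parallel>Z\<parallel>\<^sub>F < t\<close> the total error \<open>E = B + Z\<close> satisfies \<open>\<parallel>E v\<parallel> \<le> \<epsilon> \<parallel>v\<parallel>\<close> with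
  \<open>\<epsilon> = \<parallel>B\<parallel>\<^sub>2 + t\<close>, because the Frobenius norm dominates the spectral norm. By Weyl's inequality \<open>E\<close>
  moves each singular value by at most \<open>\<epsilon>\<close>. The matrix \<open>H\<close> of rank \<open>r\<close> has \<open>r\<close> singular values that are
  at least \<open>s\<close>, and the others vanish. Hence for every threshold between \<open>\<epsilon>\<close> and \<open>s - \<epsilon>\<close> exactly \<open>r\<close>
  singular values of \<open>H + E\<close> exceed it (\<open>threshold_rank_eq_rank_of_perturbation\<close>). By Markov's
  inequality for \<open>\<parallel>Z\<parallel>\<^sub>F\<^sup>2\<close>, the complementary event has probability at most \<open>V / t\<^sup>2\<close>.

  The bounds on singular values come from one variational principle,
  \<open>threshold_rank_le_iff\<close>: at most \<open>k\<close> singular values of \<open>A\<close> exceed \<open>\<tau>\<close> if and only if \<open>k\<close> linear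
  conditions on \<open>v\<close> suffice to enforce \<open>\<parallel>A v\<parallel> \<le> \<tau> \<parallel>v\<parallel>\<close>. It yields Weyl's inequality
  (\<open>threshold_rank_perturbation\<close>) and the bound by the rank (\<open>threshold_rank_le_rank\<close>). It rests on an
  orthonormal basis of singular vectors (\<open>singular_basis\<close>), that is, on the spectral theorem for
  \<open>A\<^sup>* A\<close>.

  There is also a measure-theoretic point: the event in question must be measurable. By Weyl's
  inequality the set of matrices with at least \<open>k\<close> singular values above \<open>\<tau>\<close> is open
  (\<open>open_threshold_rank_ge\<close>), and a monotonicity argument reduces the uncountably many thresholds to
  rational ones.
\<close>

(* The dot is reserved for the scalar product of the vectors on which matrices act. *)
unbundle no inner_syntax

section \<open>Underdetermined linear systems\<close>

text \<open>Dimension arguments enter through this lemma: an orthogonal complement is nonzero, or two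
  subspaces meet, because fewer equations than unknowns leave a nonzero solution. The proof eliminates
  one unknown by means of one equation. Index sets are arbitrary finite sets, so that equations may be
  indexed by vectors and unknowns by a set of singular values.\<close>

lemma underdetermined_system_nontrivial_solution:
  fixes a :: "'i \<Rightarrow> 'j \<Rightarrow> 'a :: field"
  assumes "finite Q" "finite P" "card Q < card P"
  shows "\<exists>c. (\<exists>j\<in>P. c j \<noteq> 0) \<and> (\<forall>j. j \<notin> P \<longrightarrow> c j = 0) \<and> (\<forall>i\<in>Q. (\<Sum>j\<in>P. a i j * c j) = 0)"
  using assms
proof (induction Q arbitrary: P a rule: finite_induct)
  case empty
  then obtain p where "p \<in> P" by fastforce
  then show ?case
    by (intro exI[of _ "\<lambda>j. if j = p then 1 else 0"]) auto
next
  case (insert q Q)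
  show ?case
  proof (cases "\<forall>j\<in>P. a q j = 0")
    case True
    have "card Q < card P" using insert by simp
    from insert.IH[OF insert.prems(1) this, of a] True show ?thesis by auto
  next
    case False
    then obtain p where p: "p \<in> P" "a q p \<noteq> 0" by auto
    have fin: "finite (P - {p})" and "card Q < card (P - {p})"
      using insert p by auto
    from insert.IH[OF this, of "\<lambda>i j. a i j - a i p * a q j / a q p"]
    obtain c where c: "\<exists>j\<in>P - {p}. c j \<noteq> 0" "\<forall>j. j \<notin> P - {p} \<longrightarrow> c j = 0"
        "\<forall>i\<in>Q. (\<Sum>j\<in>P - {p}. (a i j - a i p * a q j / a q p) * c j) = 0"
      by blast
    define c' where "c' = c(p := - (\<Sum>j\<in>P - {p}. a q j * c j) / a q p)"
    \<comment> \<open>Gaussian elimination: the pivot equation determines the value at \<open>p\<close>.\<close>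
    have split: "(\<Sum>j\<in>P. a i j * c' j)
        = a i p * c' p + (\<Sum>j\<in>P - {p}. a i j * c j)" for i
      using insert.prems(1) p by (subst sum.remove[of P p]) (auto simp: c'_def intro!: sum.cong)
    have "(\<Sum>j\<in>P. a q j * c' j) = 0"
      unfolding split using p by (simp add: c'_def)
    moreover have "(\<Sum>j\<in>P. a i j * c' j) = 0" if "i \<in> Q" for i
    proof -
      have "0 = (\<Sum>j\<in>P - {p}. a i j * c j - (a i p / a q p) * (a q j * c j))"
        using c(3) that by (simp add: algebra_simps)
      also have "\<dots> = (\<Sum>j\<in>P - {p}. a i j * c j) - (a i p / a q p) * (\<Sum>j\<in>P - {p}. a q j * c j)"
        by (simp add: sum_subtractf sum_distrib_left)
      finally show ?thesis unfolding split by (simp add: c'_def)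
    qed
    moreover have "\<exists>j\<in>P. c' j \<noteq> 0" "\<forall>j. j \<notin> P \<longrightarrow> c' j = 0"
      using c p by (auto simp: c'_def)
    ultimately show ?thesis by blast
  qed
qed

section \<open>Unitary diagonalization of Hermitian matrices\<close>

text \<open>A Schur decomposition \<open>A = P T P\<^sup>-\<^sup>1\<close> provides the flag of the spans \<open>V\<^sub>k\<close> of the first \<open>k\<close> columns
  of \<open>P\<close>, and \<open>A - T\<^sub>k\<^sub>k\<close> maps \<open>V\<^sub>k\<^sub>+\<^sub>1\<close> into \<open>V\<^sub>k\<close>. Apply such factors to a nonzero vector of \<open>S\<close> until the
  result first becomes zero: the last nonzero vector is an eigenvector, and it still lies in \<open>S\<close>.
  For \<open>S\<close> the orthogonal complement of eigenvectors that are already known, this replaces the passage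
  to the restriction of \<open>A\<close> to a subspace.\<close>

lemma invariant_set_has_eigenvector:
  fixes A :: "complex mat"
  assumes A: "A \<in> carrier_mat n n"
    and S: "S \<subseteq> carrier_vec n" "x \<in> S" "x \<noteq> 0\<^sub>v n"
    and inv: "\<And>v e. v \<in> S \<Longrightarrow> A *\<^sub>v v - e \<cdot>\<^sub>v v \<in> S"
  shows "\<exists>v\<in>S. v \<noteq> 0\<^sub>v n \<and> (\<exists>e. A *\<^sub>v v = e \<cdot>\<^sub>v v)"
proof -
  obtain es where es: "char_poly A = (\<Prod>e\<leftarrow>es. [:- e, 1:])"
    using char_poly_factorized[OF A] by blast
  obtain T where T: "T \<in> carrier_mat n n" "upper_triangular T" "similar_mat A T"
    using schur_decomposition_exists[OF A es] by blast
  obtain P Q where wit: "similar_mat_wit A T P Q"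
    using T(3) unfolding similar_mat_def by blast
  note w = similar_mat_witD2[OF A wit]
  have P: "P \<in> carrier_mat n n" and Q: "Q \<in> carrier_mat n n" using w by auto
  have flag: "\<exists>v\<in>S. v \<noteq> 0\<^sub>v n \<and> (\<exists>e. A *\<^sub>v v = e \<cdot>\<^sub>v v)"
    if "k \<le> n" "c \<in> carrier_vec n" "c \<noteq> 0\<^sub>v n" "P *\<^sub>v c \<in> S" "\<And>i. k \<le> i \<Longrightarrow> i < n \<Longrightarrow> c $ i = 0" for k c
    using that
  proof (induction k arbitrary: c)
    case 0
    then have "c = 0\<^sub>v n" by (intro eq_vecI) auto
    with 0 show ?case by simp
  next
    case (Suc k)
    define e where "e = T $$ (k, k)"
    define d where "d = T *\<^sub>v c - e \<cdot>\<^sub>v c"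
    have k: "k < n" using Suc.prems by simp
    have d: "d \<in> carrier_vec n" using T Suc.prems by (auto simp: d_def)
    have AP: "A *\<^sub>v (P *\<^sub>v c) = P *\<^sub>v (T *\<^sub>v c)"
    proof -
      have "P * T * Q * P = P * T * (Q * P)"
        by (rule assoc_mult_mat[of _ n n _ n _ n]) (use P Q T(1) in auto)
      then have "A * P = P * T" using w(2,3) P T(1) by simp
      then show ?thesis
        using assoc_mult_mat_vec[OF A P Suc.prems(2)] assoc_mult_mat_vec[OF P T(1) Suc.prems(2)]
        by simp
    qed
    have Pd: "P *\<^sub>v d = A *\<^sub>v (P *\<^sub>v c) - e \<cdot>\<^sub>v (P *\<^sub>v c)"
      unfolding d_def AP using P T(1) Suc.prems(2)
      by (simp add: mult_minus_distrib_mat_vec[of _ n n] mult_mat_vec[of _ n n])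
    have dS: "P *\<^sub>v d \<in> S" unfolding Pd using inv Suc.prems by blast
    have d0: "d $ i = 0" if "k \<le> i" "i < n" for i
    proof -
      have "(T *\<^sub>v c) $ i = (\<Sum>j<n. T $$ (i, j) * c $ j)"
        using T(1) Suc.prems(2) that by (simp add: scalar_prod_def atLeast0LessThan)
      also have "\<dots> = (\<Sum>j<n. if j = k then T $$ (i, j) * c $ j else 0)"
      proof (intro sum.cong refl)
        fix j assume "j \<in> {..<n}"
        then show "T $$ (i, j) * c $ j = (if j = k then T $$ (i, j) * c $ j else 0)"
          using Suc.prems(5)[of j] T(1) that upper_triangularD[OF T(2), of j i]
          by (cases "j < k") auto
      qed
      also have "\<dots> = T $$ (i, k) * c $ k" using k by simp
      finally have *: "(T *\<^sub>v c) $ i = T $$ (i, k) * c $ k" .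
      show ?thesis
      proof (cases "i = k")
        case True
        then show ?thesis using * that Suc.prems(2) T(1) by (simp add: d_def e_def)
      next
        case False
        then have "T $$ (i, k) = 0" "c $ i = 0"
          using upper_triangularD[OF T(2), of k i] T(1) that Suc.prems(5)[of i] by auto
        then show ?thesis using * that Suc.prems(2) T(1) by (simp add: d_def)
      qed
    qed
    show ?case
    proof (cases "d = 0\<^sub>v n")
      case False
      show ?thesis by (rule Suc.IH[OF _ d False dS d0]) (use k in auto)
    next
      case True
      have Pc: "P *\<^sub>v c \<in> carrier_vec n" using P Suc.prems(2) by simp
      have "P *\<^sub>v d = 0\<^sub>v n" unfolding True using P by (intro eq_vecI) auto
      then have "(A *\<^sub>v (P *\<^sub>v c) - e \<cdot>\<^sub>v (P *\<^sub>v c)) $ i = 0" if "i < n" for i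
        unfolding Pd using that by simp
      then have "A *\<^sub>v (P *\<^sub>v c) = e \<cdot>\<^sub>v (P *\<^sub>v c)"
        using A P by (intro eq_vecI) auto
      moreover have "P *\<^sub>v c \<noteq> 0\<^sub>v n"
      proof
        assume "P *\<^sub>v c = 0\<^sub>v n"
        moreover have "Q *\<^sub>v (P *\<^sub>v c) = c"
          using w(2) assoc_mult_mat_vec[OF Q P Suc.prems(2)] Suc.prems(2) by simp
        ultimately have "c = Q *\<^sub>v 0\<^sub>v n" by simp
        also have "\<dots> = 0\<^sub>v n" using Q by (intro eq_vecI) auto
        finally show False using Suc.prems(3) by simp
      qed
      ultimately show ?thesis using Suc.prems(4) by blast
    qed
  qed
  have x: "x \<in> carrier_vec n" using S by blast
  have P0: "P *\<^sub>v 0\<^sub>v n = 0\<^sub>v n" using P by (intro eq_vecI) auto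
  have PQx: "P *\<^sub>v (Q *\<^sub>v x) = x"
    using w(1) assoc_mult_mat_vec[OF P Q x] x by simp
  show ?thesis
    by (rule flag[of n "Q *\<^sub>v x"]) (use PQx P0 S P Q x in auto)
qed

lemma cscalar_prod_sum:
  fixes v w :: "complex vec"
  shows "v \<bullet>c w = (\<Sum>i<dim_vec w. v $ i * cnj (w $ i))"
  by (simp add: scalar_prod_def atLeast0LessThan)

lemma cnj_cscalar_prod:
  fixes v w :: "complex vec"
  assumes "v \<in> carrier_vec n" "w \<in> carrier_vec n"
  shows "cnj (v \<bullet>c w) = w \<bullet>c v"
  using assms by (simp add: cscalar_prod_sum mult.commute)

lemma l2_norm_vec_nonneg [simp]: "0 \<le> l2_norm_vec v"
  by (simp add: l2_norm_vec_def sum_nonneg)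

lemma l2_norm_vec_sq: "(l2_norm_vec v)\<^sup>2 = (\<Sum>i<dim_vec v. (cmod (v $ i))\<^sup>2)"
  by (simp add: l2_norm_vec_def sum_nonneg)

lemma cscalar_prod_self: "v \<bullet>c v = complex_of_real ((l2_norm_vec v)\<^sup>2)"
  unfolding cscalar_prod_sum l2_norm_vec_sq of_real_sum
  by (simp add: complex_norm_square[symmetric])

lemma l2_norm_vec_eq_0_iff: "v \<in> carrier_vec n \<Longrightarrow> l2_norm_vec v = 0 \<longleftrightarrow> v = 0\<^sub>v n"
  by (auto simp: l2_norm_vec_def sum_nonneg_eq_0_iff vec_eq_iff)

lemma mat_adjoint_carrier [simp]: "A \<in> carrier_mat m n \<Longrightarrow> mat_adjoint A \<in> carrier_mat n m"
  by (auto simp: mat_adjoint_def)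

lemma mat_adjoint_index:
  fixes A :: "complex mat"
  assumes "A \<in> carrier_mat m n" "i < n" "j < m"
  shows "mat_adjoint A $$ (i, j) = cnj (A $$ (j, i))"
  using assms by (simp add: mat_adjoint_def mat_of_rows_def)

lemma mat_adjoint_cscalar_prod:
  fixes A :: "complex mat"
  assumes A: "A \<in> carrier_mat m n" and v: "v \<in> carrier_vec n" and w: "w \<in> carrier_vec m"
  shows "(A *\<^sub>v v) \<bullet>c w = v \<bullet>c (mat_adjoint A *\<^sub>v w)"
proof -
  have "(A *\<^sub>v v) \<bullet>c w = (\<Sum>i<m. (\<Sum>j<n. A $$ (i, j) * v $ j) * cnj (w $ i))"
    using A v w by (simp add: cscalar_prod_sum scalar_prod_def atLeast0LessThan)
  also have "\<dots> = (\<Sum>i<m. \<Sum>j<n. v $ j * (A $$ (i, j) * cnj (w $ i)))"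
    unfolding sum_distrib_right by (simp add: mult_ac)
  also have "\<dots> = (\<Sum>j<n. \<Sum>i<m. v $ j * (A $$ (i, j) * cnj (w $ i)))"
    by (rule sum.swap)
  also have "\<dots> = (\<Sum>j<n. v $ j * (\<Sum>i<m. A $$ (i, j) * cnj (w $ i)))"
    by (simp add: sum_distrib_left)
  also have "\<dots> = v \<bullet>c (mat_adjoint A *\<^sub>v w)"
    using A v w
    by (simp add: cscalar_prod_sum scalar_prod_def atLeast0LessThan mat_adjoint_index
        carrier_matD[OF mat_adjoint_carrier[OF A]])
  finally show ?thesis .
qed

text \<open>Induction on the number of eigenvectors: the orthogonal complement of \<open>k < n\<close> of them contains a
  nonzero vector and is mapped into itself by every \<open>A - a\<close>, because \<open>A\<close> is Hermitian. So it contains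
  a further eigenvector, which only has to be normalized.\<close>

lemma hermitian_orthonormal_eigenvectors:
  fixes A :: "complex mat"
  assumes A: "A \<in> carrier_mat n n"
    and herm: "\<And>v w. v \<in> carrier_vec n \<Longrightarrow> w \<in> carrier_vec n \<Longrightarrow> (A *\<^sub>v v) \<bullet>c w = v \<bullet>c (A *\<^sub>v w)"
    and "k \<le> n"
  shows "\<exists>u e. (\<forall>i<k. u i \<in> carrier_vec n \<and> A *\<^sub>v u i = e i \<cdot>\<^sub>v u i) \<and>
               (\<forall>i<k. \<forall>j<k. u i \<bullet>c u j = (if i = j then 1 else 0))"
  using \<open>k \<le> n\<close>
proof (induction k)
  case 0
  then show ?case by simp
next
  case (Suc k)
  then obtain u e where
      ue: "\<forall>i<k. u i \<in> carrier_vec n \<and> A *\<^sub>v u i = e i \<cdot>\<^sub>v u i"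
      and "\<forall>i<k. \<forall>j<k. u i \<bullet>c u j = (if i = j then 1 else 0)"
    using Suc.IH[OF Suc_leD[OF Suc.prems]] by blast
  then have on: "u i \<bullet>c u j = (if i = j then 1 else 0)" if "i < k" "j < k" for i j
    using that by blast
  have u: "u i \<in> carrier_vec n" and eig: "A *\<^sub>v u i = e i \<cdot>\<^sub>v u i" if "i < k" for i
    using ue that by blast+
  define S where "S = {v \<in> carrier_vec n. \<forall>i<k. v \<bullet>c u i = 0}"
  obtain c where c: "\<exists>j\<in>{..<n}. c j \<noteq> 0"
      "\<forall>i\<in>{..<k}. (\<Sum>j\<in>{..<n}. cnj (u i $ j) * c j) = 0"
    using underdetermined_system_nontrivial_solution[of "{..<k}" "{..<n}" "\<lambda>i j. cnj (u i $ j)"] Suc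
    by auto
  have x: "vec n c \<in> S" "vec n c \<noteq> 0\<^sub>v n"
  proof -
    have "vec n c \<bullet>c u i = 0" if "i < k" for i
    proof -
      have "vec n c \<bullet>c u i = (\<Sum>j<n. cnj (u i $ j) * c j)"
        using u[OF that] by (simp add: cscalar_prod_sum mult.commute)
      then show ?thesis using c(2) that by simp
    qed
    then show "vec n c \<in> S" by (simp add: S_def)
    show "vec n c \<noteq> 0\<^sub>v n" using c(1) by (auto simp: vec_eq_iff)
  qed
  have "A *\<^sub>v v - a \<cdot>\<^sub>v v \<in> S" if "v \<in> S" for v a
  proof -
    have v: "v \<in> carrier_vec n" "\<And>i. i < k \<Longrightarrow> v \<bullet>c u i = 0" using that by (auto simp: S_def)
    have "(A *\<^sub>v v - a \<cdot>\<^sub>v v) \<bullet>c u i = 0" if i: "i < k" for i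
    proof -
      have "(A *\<^sub>v v) \<bullet>c u i = v \<bullet>c (e i \<cdot>\<^sub>v u i)"
        using herm[OF v(1) u[OF i]] eig[OF i] by simp
      also have "\<dots> = cnj (e i) * (v \<bullet>c u i)"
        using u[OF i] v(1) by (simp add: cscalar_prod_sum sum_distrib_left mult_ac)
      finally have "(A *\<^sub>v v) \<bullet>c u i = 0" using v(2)[OF i] by simp
      moreover have "(A *\<^sub>v v - a \<cdot>\<^sub>v v) \<bullet>c u i = (A *\<^sub>v v) \<bullet>c u i - a * (v \<bullet>c u i)"
        using u[OF i] v(1) A
        by (simp add: cscalar_prod_sum sum_distrib_left sum_subtractf[symmetric] algebra_simps)
      ultimately show ?thesis using v(2)[OF i] by simp
    qed
    then show ?thesis using v(1) A by (auto simp: S_def)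
  qed
  then obtain v a where v: "v \<in> S" "v \<noteq> 0\<^sub>v n" "A *\<^sub>v v = a \<cdot>\<^sub>v v"
    using invariant_set_has_eigenvector[OF A, of S "vec n c"] x by (auto simp: S_def)
  have vc: "v \<in> carrier_vec n" using v(1) by (simp add: S_def)
  define l where "l = l2_norm_vec v"
  have l: "l \<noteq> 0" using v(2) vc by (simp add: l_def l2_norm_vec_eq_0_iff)
  define w where "w = (1 / complex_of_real l) \<cdot>\<^sub>v v"
  have wc: "w \<in> carrier_vec n" using vc by (simp add: w_def)
  have w_eig: "A *\<^sub>v w = a \<cdot>\<^sub>v w"
    using A vc v(3) by (simp add: w_def mult_mat_vec[of _ n n] smult_smult_assoc mult.commute)
  have wu: "w \<bullet>c u i = 0" if "i < k" for i
  proof -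
    have "w \<bullet>c u i = (1 / complex_of_real l) * (v \<bullet>c u i)"
      using vc u[OF that] by (simp add: w_def cscalar_prod_sum sum_distrib_left mult_ac)
    then show ?thesis using v(1) that by (simp add: S_def)
  qed
  have uw: "u i \<bullet>c w = 0" if "i < k" for i
    using cnj_cscalar_prod[OF wc u[OF that]] wu[OF that] by simp
  have ww: "w \<bullet>c w = 1"
  proof -
    have "w \<bullet>c w = (1 / complex_of_real l)\<^sup>2 * (v \<bullet>c v)"
      using vc by (simp add: w_def cscalar_prod_sum sum_distrib_left power2_eq_square mult_ac)
    also have "\<dots> = 1"
      using l by (simp add: cscalar_prod_self l_def[symmetric] power_divide)
    finally show ?thesis .
  qed
  show ?case
  proof (intro exI[of _ "u(k := w)"] exI[of _ "e(k := a)"] conjI allI impI)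
    fix i assume "i < Suc k"
    then show "(u(k := w)) i \<in> carrier_vec n"
      "A *\<^sub>v (u(k := w)) i = (e(k := a)) i \<cdot>\<^sub>v (u(k := w)) i"
      using u eig wc w_eig by (auto simp: less_Suc_eq)
  next
    fix i j assume "i < Suc k" "j < Suc k"
    then show "(u(k := w)) i \<bullet>c (u(k := w)) j = (if i = j then 1 else 0)"
      using on wu uw ww by (auto simp: less_Suc_eq)
  qed
qed

section \<open>Singular values and the threshold rank\<close>

text \<open>The columns of \<open>U\<close> are an orthonormal eigenbasis of \<open>A\<^sup>* A\<close>, so that in the coordinates \<open>c\<close> both
  norms become diagonal. The characteristic polynomial of \<open>A\<^sup>* A\<close> is that of the diagonal matrix of
  the eigenvalues, which identifies the numbers \<open>\<sigma> i\<close> with the singular values, with the right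
  multiplicities.\<close>

lemma singular_basis:
  fixes A :: "complex mat"
  assumes A: "A \<in> carrier_mat m n"
  obtains U U' \<sigma> where
    "U \<in> carrier_mat n n" "U' \<in> carrier_mat n n" "U * U' = 1\<^sub>m n" "U' * U = 1\<^sub>m n"
    "\<And>c. c \<in> carrier_vec n \<Longrightarrow> (l2_norm_vec (U *\<^sub>v c))\<^sup>2 = (\<Sum>i<n. (cmod (c $ i))\<^sup>2)"
    "\<And>c. c \<in> carrier_vec n \<Longrightarrow>
       (l2_norm_vec (A *\<^sub>v (U *\<^sub>v c)))\<^sup>2 = (\<Sum>i<n. (\<sigma> i)\<^sup>2 * (cmod (c $ i))\<^sup>2)"
    "\<And>i. i < n \<Longrightarrow> 0 \<le> \<sigma> i"
    "mset (singular_values A) = mset (map \<sigma> [0..<n])"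
proof -
  define G where "G = mat_adjoint A * A"
  note A' = mat_adjoint_carrier[OF A]
  have G: "G \<in> carrier_mat n n" unfolding G_def by (rule mult_carrier_mat[OF A' A])
  have Gv: "G *\<^sub>v v = mat_adjoint A *\<^sub>v (A *\<^sub>v v)" if "v \<in> carrier_vec n" for v
    unfolding G_def by (rule assoc_mult_mat_vec[OF A' A that])
  have AA: "(A *\<^sub>v v) \<bullet>c (A *\<^sub>v w) = v \<bullet>c (G *\<^sub>v w)"
    if "v \<in> carrier_vec n" "w \<in> carrier_vec n" for v w
    using mat_adjoint_cscalar_prod[OF A that(1), of "A *\<^sub>v w"] A that Gv by simp
  have herm: "(G *\<^sub>v v) \<bullet>c w = v \<bullet>c (G *\<^sub>v w)"
    if "v \<in> carrier_vec n" "w \<in> carrier_vec n" for v w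
  proof -
    have "(G *\<^sub>v v) \<bullet>c w = cnj (w \<bullet>c (G *\<^sub>v v))"
      using G that by (intro cnj_cscalar_prod[symmetric, of _ n]) auto
    also have "\<dots> = cnj ((A *\<^sub>v w) \<bullet>c (A *\<^sub>v v))" using AA that by simp
    also have "\<dots> = (A *\<^sub>v v) \<bullet>c (A *\<^sub>v w)"
      using A that by (intro cnj_cscalar_prod[of _ m]) auto
    finally show ?thesis using AA that by simp
  qed
  obtain u e where
      ue: "\<forall>i<n. u i \<in> carrier_vec n \<and> G *\<^sub>v u i = e i \<cdot>\<^sub>v u i"
      and "\<forall>i<n. \<forall>j<n. u i \<bullet>c u j = (if i = j then 1 else 0)"
    using hermitian_orthonormal_eigenvectors[OF G herm order_refl] by blast
  then have on: "u i \<bullet>c u j = (if i = j then 1 else 0)" if "i < n" "j < n" for i j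
    using that by blast
  have u: "u i \<in> carrier_vec n" and eig: "G *\<^sub>v u i = e i \<cdot>\<^sub>v u i" if "i < n" for i
    using ue that by blast+
  define U where "U = mat n n (\<lambda>(i, j). u j $ i)"
  define D where "D = mat n n (\<lambda>(i, j). if i = j then e i else 0)"
  define U' where "U' = mat_adjoint U"
  have U: "U \<in> carrier_mat n n" and D: "D \<in> carrier_mat n n" by (auto simp: U_def D_def)
  have U': "U' \<in> carrier_mat n n" using U by (simp add: U'_def)
  have U'U: "U' * U = 1\<^sub>m n"
  proof (rule eq_matI)
    fix i j assume "i < dim_row (1\<^sub>m n :: complex mat)" "j < dim_col (1\<^sub>m n :: complex mat)"
    then have ij: "i < n" "j < n" by auto
    have "(U' * U) $$ (i, j) = (\<Sum>k<n. U' $$ (i, k) * U $$ (k, j))"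
      using ij U U' by (simp add: scalar_prod_def atLeast0LessThan)
    also have "\<dots> = (\<Sum>k<n. cnj (u i $ k) * u j $ k)"
    proof (intro sum.cong refl)
      fix k assume "k \<in> {..<n}"
      then show "U' $$ (i, k) * U $$ (k, j) = cnj (u i $ k) * u j $ k"
        using ij by (simp add: U'_def mat_adjoint_index[OF U ij(1)]) (simp add: U_def)
    qed
    also have "\<dots> = u j \<bullet>c u i" using u[OF ij(1)] by (simp add: cscalar_prod_sum mult.commute)
    finally show "(U' * U) $$ (i, j) = 1\<^sub>m n $$ (i, j)" using on ij by auto
  qed (use U U' in auto)
  have UU': "U * U' = 1\<^sub>m n" by (rule mat_mult_left_right_inverse[OF U' U U'U])
  have GU: "G * U = U * D"
  proof (rule eq_matI)
    fix i j assume "i < dim_row (U * D)" "j < dim_col (U * D)"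
    then have ij: "i < n" "j < n" using U D by auto
    have "col U j = u j" using u[OF ij(2)] ij by (intro eq_vecI) (auto simp: U_def)
    then have "(G * U) $$ (i, j) = (G *\<^sub>v u j) $ i" using G U ij by simp
    also have "\<dots> = e j * u j $ i" using eig ij carrier_vecD[OF u[OF ij(2)]] by simp
    also have "\<dots> = (\<Sum>k<n. if k = j then u j $ i * e j else 0)" using ij by simp
    also have "\<dots> = (\<Sum>k<n. U $$ (i, k) * D $$ (k, j))"
      using ij by (intro sum.cong) (auto simp: U_def D_def)
    also have "\<dots> = (U * D) $$ (i, j)"
      using ij U D by (simp add: scalar_prod_def atLeast0LessThan)
    finally show "(G * U) $$ (i, j) = (U * D) $$ (i, j)" .
  qed (use G U D in auto)
  have GUDU: "G = U * D * U'"
    using assoc_mult_mat[OF G U U'] UU' G GU by simp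
  have "similar_mat_wit G D U U'"
    unfolding similar_mat_wit_def Let_def using G D U U' UU' U'U GUDU by auto
  then have "char_poly G = char_poly D"
    by (intro char_poly_similar) (auto simp: similar_mat_def)
  also have "\<dots> = (\<Prod>a\<leftarrow>diag_mat D. [:- a, 1:])"
    by (rule char_poly_upper_triangular[OF D]) (auto simp: D_def)
  also have "diag_mat D = map e [0..<n]"
    by (auto simp: diag_mat_def D_def)
  finally have cp: "char_poly G = (\<Prod>a\<leftarrow>map e [0..<n]. [:- a, 1:])" .
  have proots: "proots (\<Prod>a\<leftarrow>as. [:- a, 1:]) = mset as" for as :: "complex list"
  proof (induction as)
    case (Cons a as)
    have "(\<Prod>a\<leftarrow>as. [:- a, 1:]) \<noteq> 0" by (auto simp: prod_list_zero_iff)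
    then show ?case using Cons by (simp add: proots_mult del: mult_pCons_left)
  qed simp
  define \<sigma> where "\<sigma> i = sqrt (Re (e i))" for i
  have sv: "mset (singular_values A) = mset (map \<sigma> [0..<n])"
    unfolding singular_values_def G_def[symmetric] cp proots
    by (simp add: \<sigma>_def[abs_def] image_mset.compositionality o_def)
  have isom: "(U *\<^sub>v c) \<bullet>c (U *\<^sub>v d) = c \<bullet>c d"
    if "c \<in> carrier_vec n" "d \<in> carrier_vec n" for c d
    using mat_adjoint_cscalar_prod[OF U that(1), of "U *\<^sub>v d"] U
      assoc_mult_mat_vec[OF U' U that(2)] U'U that by (simp add: U'_def)
  have norm_U: "(l2_norm_vec (U *\<^sub>v c))\<^sup>2 = (\<Sum>i<n. (cmod (c $ i))\<^sup>2)"
    if "c \<in> carrier_vec n" for c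
    using isom[OF that that] that unfolding cscalar_prod_self of_real_eq_iff
    by (simp add: l2_norm_vec_sq)
  have norm_AU: "complex_of_real ((l2_norm_vec (A *\<^sub>v (U *\<^sub>v c)))\<^sup>2)
      = (\<Sum>i<n. cnj (e i) * of_real ((cmod (c $ i))\<^sup>2))"
    if c: "c \<in> carrier_vec n" for c
  proof -
    have Uc: "U *\<^sub>v c \<in> carrier_vec n" using U c by simp
    have Dc: "D *\<^sub>v c \<in> carrier_vec n" using D c by simp
    have "G *\<^sub>v (U *\<^sub>v c) = U *\<^sub>v (D *\<^sub>v c)"
      using assoc_mult_mat_vec[OF G U c] assoc_mult_mat_vec[OF U D c] GU by simp
    then have "complex_of_real ((l2_norm_vec (A *\<^sub>v (U *\<^sub>v c)))\<^sup>2) = c \<bullet>c (D *\<^sub>v c)"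
      unfolding cscalar_prod_self[symmetric] AA[OF Uc Uc] using isom[OF c Dc] by simp
    also have "\<dots> = (\<Sum>i<n. c $ i * cnj ((D *\<^sub>v c) $ i))"
      using D c by (simp add: cscalar_prod_sum)
    also have "\<dots> = (\<Sum>i<n. cnj (e i) * of_real ((cmod (c $ i))\<^sup>2))"
    proof (intro sum.cong refl)
      fix i assume "i \<in> {..<n}"
      then have i: "i < n" by simp
      have "(D *\<^sub>v c) $ i = (\<Sum>k<n. D $$ (i, k) * c $ k)"
        using i D c by (simp add: scalar_prod_def atLeast0LessThan)
      also have "\<dots> = (\<Sum>k<n. if k = i then e i * c $ i else 0)"
        using i by (intro sum.cong) (auto simp: D_def)
      finally have "(D *\<^sub>v c) $ i = e i * c $ i" using i by simp
      then show "c $ i * cnj ((D *\<^sub>v c) $ i) = cnj (e i) * of_real ((cmod (c $ i))\<^sup>2)"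
        by (simp only: complex_norm_square) (simp add: mult_ac)
    qed
    finally show ?thesis .
  qed
  \<comment> \<open>Evaluated at the \<open>i\<close>-th unit vector, the norm formula shows that the eigenvalue is real and nonnegative.\<close>
  have e_real: "e i = of_real ((\<sigma> i)\<^sup>2)" "0 \<le> \<sigma> i" if i: "i < n" for i
  proof -
    have "(\<Sum>j<n. cnj (e j) * of_real ((cmod (unit_vec n i $ j :: complex))\<^sup>2))
        = (\<Sum>j<n. if j = i then cnj (e i) else 0)"
      using i by (intro sum.cong) (auto simp: unit_vec_def)
    then have "complex_of_real ((l2_norm_vec (A *\<^sub>v (U *\<^sub>v unit_vec n i)))\<^sup>2) = cnj (e i)"
      using norm_AU[OF unit_vec_carrier] i by simp
    then have "e i = complex_of_real ((l2_norm_vec (A *\<^sub>v (U *\<^sub>v unit_vec n i)))\<^sup>2)"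
      by (metis complex_cnj_cnj complex_cnj_complex_of_real)
    then show "e i = of_real ((\<sigma> i)\<^sup>2)" "0 \<le> \<sigma> i" by (auto simp: \<sigma>_def)
  qed
  have AU: "(l2_norm_vec (A *\<^sub>v (U *\<^sub>v c)))\<^sup>2 = (\<Sum>i<n. (\<sigma> i)\<^sup>2 * (cmod (c $ i))\<^sup>2)"
    if "c \<in> carrier_vec n" for c
  proof -
    have "complex_of_real ((l2_norm_vec (A *\<^sub>v (U *\<^sub>v c)))\<^sup>2)
        = of_real (\<Sum>i<n. (\<sigma> i)\<^sup>2 * (cmod (c $ i))\<^sup>2)"
      unfolding norm_AU[OF that] of_real_sum by (intro sum.cong) (auto simp: e_real(1))
    then show ?thesis by (simp only: of_real_eq_iff)
  qed
  show ?thesis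
    by (rule that[OF U U' UU' U'U norm_U AU e_real(2) sv])
qed

lemma threshold_rank_eq_card:
  assumes "mset (singular_values A) = mset (map \<sigma> [0..<n])"
  shows "threshold_rank \<tau> A = card {i. i < n \<and> \<tau> < \<sigma> i}"
proof -
  have "mset (filter (\<lambda>x. \<tau> < x) (singular_values A)) = mset (filter (\<lambda>x. \<tau> < x) (map \<sigma> [0..<n]))"
    by (simp only: mset_filter assms)
  then have "threshold_rank \<tau> A = length (filter (\<lambda>x. \<tau> < x) (map \<sigma> [0..<n]))"
    unfolding threshold_rank_def by (rule mset_eq_length)
  also have "\<dots> = card {i. i < n \<and> \<tau> < \<sigma> i}"
    by (subst length_filter_conv_card) (auto intro!: arg_cong[where f = card])
  finally show ?thesis .
qed

text \<open>This is the Courant--Fischer principle in the form of a count. A condition \<open>c \<bullet> v = 0\<close> with \<open>c\<close>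
  nonzero cuts out a hyperplane, and the threshold rank is the least number of hyperplanes on whose
  intersection \<open>A\<close> stretches no vector by more than \<open>\<tau>\<close>. Annihilating the coordinates that belong to
  singular values above \<open>\<tau>\<close> shows that so many conditions suffice. If there were fewer conditions,
  then a nonzero combination of the corresponding singular vectors would satisfy all of them, and
  \<open>A\<close> would stretch it by more than \<open>\<tau>\<close>.

  Since no eigenvalue occurs on the right-hand side, perturbation bounds and the comparison with the
  rank become statements about the length of \<open>A v\<close> only.\<close>

theorem threshold_rank_le_iff:
  assumes A: "A \<in> carrier_mat m n" and "0 \<le> \<tau>"
  shows "threshold_rank \<tau> A \<le> k \<longleftrightarrow>
    (\<exists>C. finite C \<and> C \<subseteq> carrier_vec n \<and> card C \<le> k \<and>
      (\<forall>v\<in>carrier_vec n. (\<forall>c\<in>C. c \<bullet> v = 0) \<longrightarrow> l2_norm_vec (A *\<^sub>v v) \<le> \<tau> * l2_norm_vec v))"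
proof
  obtain U U' \<sigma> where U: "U \<in> carrier_mat n n" and U': "U' \<in> carrier_mat n n"
    and UU': "U * U' = 1\<^sub>m n" and "U' * U = 1\<^sub>m n"
    and norm_U: "\<And>c. c \<in> carrier_vec n \<Longrightarrow> (l2_norm_vec (U *\<^sub>v c))\<^sup>2 = (\<Sum>i<n. (cmod (c $ i))\<^sup>2)"
    and norm_AU: "\<And>c. c \<in> carrier_vec n \<Longrightarrow>
       (l2_norm_vec (A *\<^sub>v (U *\<^sub>v c)))\<^sup>2 = (\<Sum>i<n. (\<sigma> i)\<^sup>2 * (cmod (c $ i))\<^sup>2)"
    and \<sigma>: "\<And>i. i < n \<Longrightarrow> 0 \<le> \<sigma> i"
    and sv: "mset (singular_values A) = mset (map \<sigma> [0..<n])"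
    by (rule singular_basis[OF A]) (rule that)
  define P where "P = {i. i < n \<and> \<tau> < \<sigma> i}"
  have fin: "finite P" and thr: "threshold_rank \<tau> A = card P"
    using threshold_rank_eq_card[OF sv] by (auto simp: P_def)
  {
    assume le: "threshold_rank \<tau> A \<le> k"
    define C where "C = (\<lambda>i. row U' i) ` P"
    have "card C \<le> k"
      using card_image_le[OF fin, of "\<lambda>i. row U' i"] le thr by (simp add: C_def)
    moreover have "finite C" "C \<subseteq> carrier_vec n"
      using fin U' by (auto simp: C_def)
    moreover have "l2_norm_vec (A *\<^sub>v v) \<le> \<tau> * l2_norm_vec v"
      if v: "v \<in> carrier_vec n" "\<forall>c\<in>C. c \<bullet> v = 0" for v
    proof -
      define d where "d = U' *\<^sub>v v"
      have d: "d \<in> carrier_vec n" using U' v by (simp add: d_def)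
      have Ud: "U *\<^sub>v d = v"
        using assoc_mult_mat_vec[OF U U' v(1)] UU' v by (simp add: d_def)
      have d0: "d $ i = 0" if "i \<in> P" for i
        using v that U' by (auto simp: d_def C_def P_def)
      have term_le: "(\<sigma> i)\<^sup>2 * (cmod (d $ i))\<^sup>2 \<le> \<tau>\<^sup>2 * (cmod (d $ i))\<^sup>2" if "i < n" for i
        using d0[of i] \<sigma>[OF that] that
        by (cases "i \<in> P") (auto simp: P_def intro!: mult_right_mono power_mono)
      have "(l2_norm_vec (A *\<^sub>v v))\<^sup>2 = (\<Sum>i<n. (\<sigma> i)\<^sup>2 * (cmod (d $ i))\<^sup>2)"
        using norm_AU[OF d] by (simp add: Ud)
      also have "\<dots> \<le> (\<Sum>i<n. \<tau>\<^sup>2 * (cmod (d $ i))\<^sup>2)"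
        by (intro sum_mono) (use term_le in simp)
      also have "\<dots> = \<tau>\<^sup>2 * (\<Sum>i<n. (cmod (d $ i))\<^sup>2)"
        by (simp add: sum_distrib_left)
      also have "\<dots> = (\<tau> * l2_norm_vec v)\<^sup>2"
        using norm_U[OF d] by (simp add: Ud power_mult_distrib)
      finally show ?thesis
        using \<open>0 \<le> \<tau>\<close> by (intro power2_le_imp_le[of "l2_norm_vec (A *\<^sub>v v)"]) auto
    qed
    ultimately show "\<exists>C. finite C \<and> C \<subseteq> carrier_vec n \<and> card C \<le> k \<and>
      (\<forall>v\<in>carrier_vec n. (\<forall>c\<in>C. c \<bullet> v = 0) \<longrightarrow> l2_norm_vec (A *\<^sub>v v) \<le> \<tau> * l2_norm_vec v)"
      by blast
  next
    assume "\<exists>C. finite C \<and> C \<subseteq> carrier_vec n \<and> card C \<le> k \<and>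
      (\<forall>v\<in>carrier_vec n. (\<forall>c\<in>C. c \<bullet> v = 0) \<longrightarrow> l2_norm_vec (A *\<^sub>v v) \<le> \<tau> * l2_norm_vec v)"
    then obtain C where C: "finite C" "C \<subseteq> carrier_vec n" "card C \<le> k"
      and small: "\<And>v. v \<in> carrier_vec n \<Longrightarrow> \<forall>c\<in>C. c \<bullet> v = 0 \<Longrightarrow>
        l2_norm_vec (A *\<^sub>v v) \<le> \<tau> * l2_norm_vec v"
      by blast
    show "threshold_rank \<tau> A \<le> k"
    proof (rule ccontr)
      assume "\<not> ?thesis"
      then have "card C < card P" using C(3) thr by simp
      then obtain d where d: "\<exists>j\<in>P. d j \<noteq> 0" "\<forall>j. j \<notin> P \<longrightarrow> d j = 0"
          "\<forall>c\<in>C. (\<Sum>j\<in>P. (c \<bullet> col U j) * d j) = 0"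
        using underdetermined_system_nontrivial_solution[OF C(1) fin, of "\<lambda>c j. c \<bullet> col U j"]
        by blast
      define x where "x = vec n d"
      have x: "x \<in> carrier_vec n" by (simp add: x_def)
      have "c \<bullet> (U *\<^sub>v x) = 0" if "c \<in> C" for c
      proof -
        have c: "c \<in> carrier_vec n" using C that by blast
        have "c \<bullet> (U *\<^sub>v x) = (\<Sum>i<n. \<Sum>j<n. c $ i * (U $$ (i, j) * d j))"
          using U by (simp add: x_def scalar_prod_def atLeast0LessThan sum_distrib_left)
        also have "\<dots> = (\<Sum>j<n. \<Sum>i<n. c $ i * (U $$ (i, j) * d j))"
          by (rule sum.swap)
        also have "\<dots> = (\<Sum>j<n. (c \<bullet> col U j) * d j)"
          using U by (simp add: scalar_prod_def atLeast0LessThan sum_distrib_right mult.assoc)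
        also have "\<dots> = (\<Sum>j\<in>P. (c \<bullet> col U j) * d j)"
          using d(2) by (intro sum.mono_neutral_right) (auto simp: P_def)
        finally show ?thesis using d(3) that by simp
      qed
      moreover have Ux: "U *\<^sub>v x \<in> carrier_vec n" using U x by simp
      ultimately have "l2_norm_vec (A *\<^sub>v (U *\<^sub>v x)) \<le> \<tau> * l2_norm_vec (U *\<^sub>v x)"
        using small by blast
      then have "(l2_norm_vec (A *\<^sub>v (U *\<^sub>v x)))\<^sup>2 \<le> (\<tau> * l2_norm_vec (U *\<^sub>v x))\<^sup>2"
        by (intro power_mono) auto
      then have "(\<Sum>i<n. (\<sigma> i)\<^sup>2 * (cmod (x $ i))\<^sup>2) \<le> (\<Sum>i<n. \<tau>\<^sup>2 * (cmod (x $ i))\<^sup>2)"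
        unfolding norm_AU[OF x] power_mult_distrib norm_U[OF x] sum_distrib_left .
      moreover have "(\<Sum>i<n. \<tau>\<^sup>2 * (cmod (x $ i))\<^sup>2) < (\<Sum>i<n. (\<sigma> i)\<^sup>2 * (cmod (x $ i))\<^sup>2)"
      proof (rule sum_strict_mono_ex1)
        show "\<forall>i\<in>{..<n}. \<tau>\<^sup>2 * (cmod (x $ i))\<^sup>2 \<le> (\<sigma> i)\<^sup>2 * (cmod (x $ i))\<^sup>2"
        proof
          fix i assume "i \<in> {..<n}"
          then show "\<tau>\<^sup>2 * (cmod (x $ i))\<^sup>2 \<le> (\<sigma> i)\<^sup>2 * (cmod (x $ i))\<^sup>2"
            using d(2) \<open>0 \<le> \<tau>\<close>
            by (cases "i \<in> P") (auto simp: x_def P_def intro!: mult_right_mono power_mono)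
        qed
        obtain j where "j \<in> P" "d j \<noteq> 0" using d(1) by blast
        then show "\<exists>i\<in>{..<n}. \<tau>\<^sup>2 * (cmod (x $ i))\<^sup>2 < (\<sigma> i)\<^sup>2 * (cmod (x $ i))\<^sup>2"
          using \<open>0 \<le> \<tau>\<close>
          by (intro bexI[of _ j]) (auto simp: x_def P_def intro!: mult_strict_right_mono power_strict_mono)
      qed simp
      ultimately show False by simp
    qed
  }
qed

text \<open>Weyl's inequality for singular values: linear conditions under which \<open>A'\<close> stretches vectors by
  at most \<open>\<tau>\<close> are conditions under which \<open>A\<close> stretches them by at most \<open>\<tau> + \<epsilon>\<close>.\<close>

corollary threshold_rank_perturbation:
  assumes A: "A \<in> carrier_mat m n" and A': "A' \<in> carrier_mat m' n"
    and "0 \<le> \<tau>" "0 \<le> \<epsilon>"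
    and close: "\<And>v. v \<in> carrier_vec n \<Longrightarrow>
      l2_norm_vec (A *\<^sub>v v) \<le> l2_norm_vec (A' *\<^sub>v v) + \<epsilon> * l2_norm_vec v"
  shows "threshold_rank (\<tau> + \<epsilon>) A \<le> threshold_rank \<tau> A'"
proof -
  obtain C where C: "finite C" "C \<subseteq> carrier_vec n" "card C \<le> threshold_rank \<tau> A'"
    and small: "\<And>v. v \<in> carrier_vec n \<Longrightarrow> \<forall>c\<in>C. c \<bullet> v = 0 \<Longrightarrow>
      l2_norm_vec (A' *\<^sub>v v) \<le> \<tau> * l2_norm_vec v"
    using threshold_rank_le_iff[OF A' \<open>0 \<le> \<tau>\<close>, of "threshold_rank \<tau> A'"] by auto
  have "l2_norm_vec (A *\<^sub>v v) \<le> (\<tau> + \<epsilon>) * l2_norm_vec v"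
    if "v \<in> carrier_vec n" "\<forall>c\<in>C. c \<bullet> v = 0" for v
    using close[OF that(1)] small[OF that] by (simp add: algebra_simps)
  then show ?thesis
    using C threshold_rank_le_iff[OF A, of "\<tau> + \<epsilon>"] \<open>0 \<le> \<tau>\<close> \<open>0 \<le> \<epsilon>\<close>
    by (meson add_nonneg_nonneg)
qed

text \<open>Here \<open>S\<close> is a maximal independent set of columns, and \<open>R\<close> holds the coordinates of all columns in
  the basis \<open>S\<close>.\<close>

lemma (in vec_space) rank_factorization:
  assumes A: "A \<in> carrier_mat n nc"
  obtains S R where "finite S" "card S = rank A"
    "\<And>i j. i < n \<Longrightarrow> j < nc \<Longrightarrow> A $$ (i, j) = (\<Sum>s\<in>S. s $ i * R s j)"
proof -
  have cols: "set (cols A) \<subseteq> carrier_vec n" using A cols_dim by blast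
  obtain S where S: "finite S" "maximal S (\<lambda>T. T \<subseteq> set (cols A) \<and> lin_indpt T)"
    using maximal_exists_superset[of "set (cols A)" "\<lambda>T. T \<subseteq> set (cols A) \<and> lin_indpt T" "{}"]
    by (auto simp: finite_lin_indpt2)
  have SA: "S \<subseteq> set (cols A)" "lin_indpt S" using S(2) by (auto simp: maximal_def)
  have Sc: "S \<subseteq> carrier_vec n" using SA cols by blast
  have "\<exists>a. \<forall>i<n. A $$ (i, j) = (\<Sum>s\<in>S. s $ i * a s)" if j: "j < nc" for j
  proof -
    have cj: "col A j \<in> set (cols A)" using A j by (auto simp: cols_def)
    have "col A j \<in> span S"
    proof (rule ccontr)
      assume not_in: "col A j \<notin> span S"
      then have "lin_indpt (S \<union> {col A j})"
        using lin_dep_iff_in_span[of S "col A j"] SA(2) Sc cj cols in_own_span[of S] by auto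
      then have "S \<union> {col A j} = S"
        using S(2) SA(1) cj unfolding maximal_def by blast
      then show False using not_in in_own_span[of S] Sc by auto
    qed
    then obtain a where "lincomb a S = col A j"
      using finite_in_span[OF S(1) Sc] by metis
    then have "A $$ (i, j) = (\<Sum>s\<in>S. s $ i * a s)" if "i < n" for i
      using lincomb_index[OF that Sc, of a] A that j by (simp add: mult.commute)
    then show ?thesis by blast
  qed
  then obtain a where "\<And>j i. j < nc \<Longrightarrow> i < n \<Longrightarrow> A $$ (i, j) = (\<Sum>s\<in>S. s $ i * a j s)"
    by metis
  then show ?thesis
    using that[of S "\<lambda>s j. a j s"] S(1) rank_card_indpt[OF A S(2)] by simp
qed

text \<open>The rows of \<open>R\<close> in a rank factorization are conditions that cut out vectors in the kernel of \<open>A\<close>.\<close>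

lemma threshold_rank_le_rank:
  assumes A: "A \<in> carrier_mat m n" and "0 \<le> \<tau>"
  shows "threshold_rank \<tau> A \<le> vec_space.rank m A"
proof -
  obtain S R where S: "finite S" "card S = vec_space.rank m A"
    and R: "\<And>i j. i < m \<Longrightarrow> j < n \<Longrightarrow> A $$ (i, j) = (\<Sum>s\<in>S. s $ i * R s j)"
    by (rule vec_space.rank_factorization[OF A]) (rule that)
  define C where "C = (\<lambda>s. vec n (R s)) ` S"
  have "l2_norm_vec (A *\<^sub>v v) \<le> \<tau> * l2_norm_vec v"
    if v: "v \<in> carrier_vec n" "\<forall>c\<in>C. c \<bullet> v = 0" for v
  proof -
    have "(A *\<^sub>v v) $ i = 0" if i: "i < m" for i
    proof -
      have "(A *\<^sub>v v) $ i = (\<Sum>j<n. \<Sum>s\<in>S. s $ i * (R s j * v $ j))"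
        using A v i R by (simp add: scalar_prod_def atLeast0LessThan sum_distrib_right mult.assoc)
      also have "\<dots> = (\<Sum>s\<in>S. \<Sum>j<n. s $ i * (R s j * v $ j))"
        by (rule sum.swap)
      also have "\<dots> = (\<Sum>s\<in>S. s $ i * (vec n (R s) \<bullet> v))"
        using v by (simp add: scalar_prod_def atLeast0LessThan sum_distrib_left)
      also have "\<dots> = 0" using v(2) by (intro sum.neutral) (auto simp: C_def)
      finally show ?thesis .
    qed
    then have "l2_norm_vec (A *\<^sub>v v) = 0" using A by (simp add: l2_norm_vec_def)
    then show ?thesis using \<open>0 \<le> \<tau>\<close> by simp
  qed
  moreover have "finite C" "C \<subseteq> carrier_vec n" "card C \<le> vec_space.rank m A"
    using S card_image_le[OF S(1), of "\<lambda>s. vec n (R s)"] by (auto simp: C_def)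
  ultimately show ?thesis
    using threshold_rank_le_iff[OF assms] by blast
qed

lemma length_singular_values:
  assumes "A \<in> carrier_mat m n"
  shows "length (singular_values A) = n"
proof -
  obtain \<sigma> where "mset (singular_values A) = mset (map \<sigma> [0..<n])"
    by (rule singular_basis[OF assms]) (rule that)
  then show ?thesis by (metis diff_zero length_map length_upt mset_eq_length)
qed

lemma threshold_rank_ge:
  assumes A: "A \<in> carrier_mat m n" and "1 \<le> r" "r \<le> n" and \<tau>: "\<tau> < singular_value A r"
  shows "r \<le> threshold_rank \<tau> A"
proof -
  let ?xs = "singular_values A"
  have len: "length ?xs = n" by (rule length_singular_values[OF A])
  have sorted: "sorted (rev ?xs)" by (simp add: singular_values_def)
  have "\<tau> < x" if "x \<in> set (take r ?xs)" for x
  proof -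
    obtain i where "i < length (take r ?xs)" "x = take r ?xs ! i"
      using \<open>x \<in> set (take r ?xs)\<close> by (metis in_set_conv_nth)
    then have "i < r" "x = ?xs ! i" by auto
    moreover have "?xs ! (r - 1) \<le> ?xs ! i"
      using \<open>i < r\<close> len assms(2,3) by (intro sorted_rev_nth_mono[OF sorted]) auto
    ultimately show ?thesis using \<tau> by (simp add: singular_value_def)
  qed
  then have "filter (\<lambda>x. \<tau> < x) (take r ?xs) = take r ?xs"
    by (simp add: filter_id_conv)
  then have "threshold_rank \<tau> A = r + length (filter (\<lambda>x. \<tau> < x) (drop r ?xs))"
    unfolding threshold_rank_def
    by (subst append_take_drop_id[symmetric, of _ r], subst filter_append)
      (use len \<open>r \<le> n\<close> in simp)
  then show ?thesis by simp
qed

lemma threshold_rank_right_continuous: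
  "\<exists>\<delta>>0. threshold_rank (\<tau> + \<delta>) A = threshold_rank \<tau> A"
proof -
  have "eventually (\<lambda>\<delta>. \<tau> < \<sigma> \<longrightarrow> \<tau> + \<delta> < \<sigma>) (at_right 0)" for \<sigma> :: real
    unfolding eventually_at_right_field by (rule exI[of _ "if \<tau> < \<sigma> then \<sigma> - \<tau> else 1"]) auto
  then have "eventually (\<lambda>\<delta>. \<forall>\<sigma>\<in>set (singular_values A). \<tau> < \<sigma> \<longrightarrow> \<tau> + \<delta> < \<sigma>) (at_right 0)"
    by (intro eventually_ball_finite) auto
  then have "eventually (\<lambda>\<delta>. 0 < \<delta> \<and> (\<forall>\<sigma>\<in>set (singular_values A). \<tau> < \<sigma> \<longrightarrow> \<tau> + \<delta> < \<sigma>)) (at_right 0)"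
    using eventually_at_right_less[of "0::real"] by (rule eventually_conj[rotated])
  then obtain \<delta> where \<delta>: "0 < \<delta>" "\<forall>\<sigma>\<in>set (singular_values A). \<tau> < \<sigma> \<longrightarrow> \<tau> + \<delta> < \<sigma>"
    using eventually_happens'[OF trivial_limit_at_right_real] by blast
  then have "filter (\<lambda>\<sigma>. \<tau> + \<delta> < \<sigma>) (singular_values A) = filter (\<lambda>\<sigma>. \<tau> < \<sigma>) (singular_values A)"
    by (intro filter_cong) auto
  then show ?thesis using \<delta>(1) by (auto simp: threshold_rank_def)
qed

section \<open>Vector norms and matrix norms\<close>

lemma l2_norm_vec_L2_set: "l2_norm_vec v = L2_set (\<lambda>i. cmod (v $ i)) {..<dim_vec v}"
  by (simp add: l2_norm_vec_def L2_set_def)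

lemma l2_norm_vec_triangle:
  assumes "v \<in> carrier_vec n" "w \<in> carrier_vec n"
  shows "l2_norm_vec (v + w) \<le> l2_norm_vec v + l2_norm_vec w"
proof -
  have "l2_norm_vec (v + w) = L2_set (\<lambda>i. cmod (v $ i + w $ i)) {..<n}"
    unfolding l2_norm_vec_L2_set using assms by (intro L2_set_cong) auto
  also have "\<dots> \<le> L2_set (\<lambda>i. cmod (v $ i) + cmod (w $ i)) {..<n}"
    by (intro L2_set_mono norm_triangle_ineq) simp
  also have "\<dots> \<le> L2_set (\<lambda>i. cmod (v $ i)) {..<n} + L2_set (\<lambda>i. cmod (w $ i)) {..<n}"
    by (rule L2_set_triangle_ineq)
  finally show ?thesis using assms by (simp add: l2_norm_vec_L2_set)
qed

lemma l2_norm_vec_smult: "l2_norm_vec (c \<cdot>\<^sub>v v) = cmod c * l2_norm_vec v"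
proof -
  have "(\<Sum>i<dim_vec v. (cmod ((c \<cdot>\<^sub>v v) $ i))\<^sup>2) = (cmod c)\<^sup>2 * (\<Sum>i<dim_vec v. (cmod (v $ i))\<^sup>2)"
    by (simp add: norm_mult power_mult_distrib sum_distrib_left)
  then show ?thesis by (simp add: l2_norm_vec_def real_sqrt_mult)
qed

lemma frobenius_norm_nonneg [simp]: "0 \<le> frobenius_norm A"
  by (simp add: frobenius_norm_def sum_nonneg)

lemma l2_norm_mult_mat_vec_le_frobenius:
  assumes A: "A \<in> carrier_mat m n" and v: "v \<in> carrier_vec n"
  shows "l2_norm_vec (A *\<^sub>v v) \<le> frobenius_norm A * l2_norm_vec v"
proof -
  have "(cmod ((A *\<^sub>v v) $ i))\<^sup>2 \<le> (\<Sum>j<n. (cmod (A $$ (i, j)))\<^sup>2) * (l2_norm_vec v)\<^sup>2"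
    if i: "i < m" for i
  proof -
    have "cmod ((A *\<^sub>v v) $ i) = cmod (\<Sum>j<n. A $$ (i, j) * v $ j)"
      using A v i by (simp add: scalar_prod_def atLeast0LessThan)
    also have "\<dots> \<le> (\<Sum>j<n. \<bar>cmod (A $$ (i, j))\<bar> * \<bar>cmod (v $ j)\<bar>)"
      by (rule order_trans[OF norm_sum]) (simp add: norm_mult)
    also have "\<dots> \<le> L2_set (\<lambda>j. cmod (A $$ (i, j))) {..<n} * L2_set (\<lambda>j. cmod (v $ j)) {..<n}"
      by (rule L2_set_mult_ineq)
    finally have "(cmod ((A *\<^sub>v v) $ i))\<^sup>2
        \<le> (L2_set (\<lambda>j. cmod (A $$ (i, j))) {..<n} * L2_set (\<lambda>j. cmod (v $ j)) {..<n})\<^sup>2"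
      by (intro power_mono) auto
    then show ?thesis
      using v by (simp add: power_mult_distrib L2_set_def l2_norm_vec_sq sum_nonneg)
  qed
  then have "(\<Sum>i<m. (cmod ((A *\<^sub>v v) $ i))\<^sup>2)
      \<le> (\<Sum>i<m. (\<Sum>j<n. (cmod (A $$ (i, j)))\<^sup>2) * (l2_norm_vec v)\<^sup>2)"
    by (intro sum_mono) simp
  then have "(l2_norm_vec (A *\<^sub>v v))\<^sup>2 \<le> (frobenius_norm A * l2_norm_vec v)\<^sup>2"
    using A by (simp add: l2_norm_vec_sq[of "A *\<^sub>v v"] frobenius_norm_def power_mult_distrib
        sum_nonneg sum_distrib_right)
  then show ?thesis by (rule power2_le_imp_le) simp
qed

text \<open>The supremum in the spectral norm is finite because of the bound by the Frobenius norm; without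
  boundedness it would carry no information.\<close>

lemma l2_norm_mult_mat_vec_le_spectral:
  assumes A: "A \<in> carrier_mat m n"
  shows "0 \<le> spectral_norm A"
    and "v \<in> carrier_vec n \<Longrightarrow> l2_norm_vec (A *\<^sub>v v) \<le> spectral_norm A * l2_norm_vec v"
proof -
  have bdd: "bdd_above ((\<lambda>v. l2_norm_vec (A *\<^sub>v v)) ` {v \<in> carrier_vec n. l2_norm_vec v \<le> 1})"
  proof (rule bdd_aboveI2)
    fix v assume "v \<in> {v \<in> carrier_vec n. l2_norm_vec v \<le> 1}"
    then show "l2_norm_vec (A *\<^sub>v v) \<le> frobenius_norm A"
      using l2_norm_mult_mat_vec_le_frobenius[OF A, of v]
        mult_left_mono[of "l2_norm_vec v" 1 "frobenius_norm A"] by auto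
  qed
  have unit: "l2_norm_vec (A *\<^sub>v v) \<le> spectral_norm A" if "v \<in> carrier_vec n" "l2_norm_vec v \<le> 1" for v
    unfolding spectral_norm_def carrier_matD(2)[OF A]
    using that by (intro cSUP_upper[OF _ bdd]) auto
  have "l2_norm_vec (A *\<^sub>v 0\<^sub>v n) \<le> spectral_norm A"
    by (rule unit) (auto simp: l2_norm_vec_def)
  then show nonneg: "0 \<le> spectral_norm A"
    by (rule order_trans[OF l2_norm_vec_nonneg])
  assume v: "v \<in> carrier_vec n"
  show "l2_norm_vec (A *\<^sub>v v) \<le> spectral_norm A * l2_norm_vec v"
  proof (cases "l2_norm_vec v = 0")
    case True
    then have "l2_norm_vec (A *\<^sub>v v) \<le> 0"
      using l2_norm_mult_mat_vec_le_frobenius[OF A v] by simp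
    then show ?thesis using True by simp
  next
    case False
    define l where "l = l2_norm_vec v"
    have l: "l > 0" using False by (auto simp: l_def less_le)
    have "l2_norm_vec (A *\<^sub>v (complex_of_real (1 / l) \<cdot>\<^sub>v v)) \<le> spectral_norm A"
      using v l by (intro unit) (auto simp: l2_norm_vec_smult norm_divide l_def)
    also have "A *\<^sub>v (complex_of_real (1 / l) \<cdot>\<^sub>v v) = complex_of_real (1 / l) \<cdot>\<^sub>v (A *\<^sub>v v)"
      by (rule mult_mat_vec[OF A v])
    finally have "l2_norm_vec (A *\<^sub>v v) / l \<le> spectral_norm A"
      using l by (simp add: l2_norm_vec_smult norm_divide)
    then show ?thesis using l by (simp add: l_def divide_le_eq)
  qed
qed

section \<open>Stability of the threshold rank\<close>

lemma threshold_rank_add: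
  assumes A: "A \<in> carrier_mat m n" and E: "E \<in> carrier_mat m n" and "0 \<le> \<tau>" "0 \<le> \<epsilon>"
    and small: "\<And>v. v \<in> carrier_vec n \<Longrightarrow> l2_norm_vec (E *\<^sub>v v) \<le> \<epsilon> * l2_norm_vec v"
  shows "threshold_rank (\<tau> + \<epsilon>) (A + E) \<le> threshold_rank \<tau> A"
    and "threshold_rank (\<tau> + \<epsilon>) A \<le> threshold_rank \<tau> (A + E)"
proof -
  have AE: "A + E \<in> carrier_mat m n" using A E by simp
  have sum: "(A + E) *\<^sub>v v = A *\<^sub>v v + E *\<^sub>v v" if "v \<in> carrier_vec n" for v
    by (rule add_mult_distrib_mat_vec[OF A E that])
  show "threshold_rank (\<tau> + \<epsilon>) (A + E) \<le> threshold_rank \<tau> A"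
  proof (rule threshold_rank_perturbation[OF AE A assms(3,4)])
    fix v :: "complex vec" assume v: "v \<in> carrier_vec n"
    have "l2_norm_vec (A *\<^sub>v v + E *\<^sub>v v) \<le> l2_norm_vec (A *\<^sub>v v) + l2_norm_vec (E *\<^sub>v v)"
      using A E v by (intro l2_norm_vec_triangle[of _ m]) auto
    then show "l2_norm_vec ((A + E) *\<^sub>v v) \<le> l2_norm_vec (A *\<^sub>v v) + \<epsilon> * l2_norm_vec v"
      using small[OF v] sum[OF v] by simp
  qed
  show "threshold_rank (\<tau> + \<epsilon>) A \<le> threshold_rank \<tau> (A + E)"
  proof (rule threshold_rank_perturbation[OF A AE assms(3,4)])
    fix v :: "complex vec" assume v: "v \<in> carrier_vec n"
    have "A *\<^sub>v v = (A + E) *\<^sub>v v + (-1) \<cdot>\<^sub>v (E *\<^sub>v v)"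
      using A E v sum[OF v] by (intro eq_vecI) auto
    moreover have "l2_norm_vec ((A + E) *\<^sub>v v + (-1) \<cdot>\<^sub>v (E *\<^sub>v v))
        \<le> l2_norm_vec ((A + E) *\<^sub>v v) + l2_norm_vec ((-1) \<cdot>\<^sub>v (E *\<^sub>v v))"
      by (rule l2_norm_vec_triangle[OF mult_mat_vec_carrier[OF AE v]]) (use E v in simp)
    ultimately show "l2_norm_vec (A *\<^sub>v v) \<le> l2_norm_vec ((A + E) *\<^sub>v v) + \<epsilon> * l2_norm_vec v"
      using small[OF v] by (simp add: l2_norm_vec_smult)
  qed
qed

text \<open>A perturbation of size \<open>\<epsilon>\<close> moves the vanishing singular values of \<open>A\<close> to at most \<open>\<epsilon>\<close>, and the \<open>r\<close>
  positive ones to at least \<open>\<sigma>\<^sub>r - \<epsilon>\<close>, so that a threshold in the gap counts exactly the latter.\<close>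

lemma threshold_rank_eq_rank_of_perturbation:
  assumes A: "A \<in> carrier_mat m n" and E: "E \<in> carrier_mat m n"
    and r: "vec_space.rank m A = r" "1 \<le> r"
    and "0 \<le> \<epsilon>"
    and small: "\<And>v. v \<in> carrier_vec n \<Longrightarrow> l2_norm_vec (E *\<^sub>v v) \<le> \<epsilon> * l2_norm_vec v"
    and \<tau>: "\<epsilon> \<le> \<tau>" "\<tau> < singular_value A r - \<epsilon>"
  shows "threshold_rank \<tau> (A + E) = r"
proof (rule antisym)
  have "threshold_rank \<tau> (A + E) \<le> threshold_rank (\<tau> - \<epsilon>) A"
    using threshold_rank_add(1)[OF A E _ \<open>0 \<le> \<epsilon>\<close> small, of "\<tau> - \<epsilon>"] \<tau> by simp
  also have "\<dots> \<le> r"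
    using threshold_rank_le_rank[OF A, of "\<tau> - \<epsilon>"] \<tau> r by simp
  finally show "threshold_rank \<tau> (A + E) \<le> r" .
  have "r \<le> n" using vec_space.rank_le_nc[OF A] r by simp
  then have "r \<le> threshold_rank (\<tau> + \<epsilon>) A"
    using \<tau> r by (intro threshold_rank_ge[OF A]) auto
  also have "\<dots> \<le> threshold_rank \<tau> (A + E)"
    using threshold_rank_add(2)[OF A E _ \<open>0 \<le> \<epsilon>\<close> small, of \<tau>] \<tau> \<open>0 \<le> \<epsilon>\<close> by simp
  finally show "r \<le> threshold_rank \<tau> (A + E)" .
qed

section \<open>Measurability of the threshold rank\<close>

lemma threshold_rank_antimono: "\<tau> \<le> \<tau>' \<Longrightarrow> threshold_rank \<tau>' A \<le> threshold_rank \<tau> A"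
  unfolding threshold_rank_def length_filter_conv_card by (intro card_mono) auto

text \<open>Lower semicontinuity: the singular values above \<open>\<tau>\<close> are finitely many, so they exceed some
  \<open>\<tau> + \<delta>\<close>, and by Weyl's inequality they still exceed \<open>\<tau>\<close> after a perturbation of size less than \<open>\<delta>\<close>.
  The topology is the product topology on the entries.\<close>

lemma open_threshold_rank_ge:
  assumes "0 \<le> \<tau>"
  shows "open {f :: nat \<times> nat \<Rightarrow> complex. k \<le> threshold_rank \<tau> (mat m n f)}" (is "open ?S")
proof (subst open_subopen, intro ballI)
  fix f assume "f \<in> ?S"
  obtain \<delta> where \<delta>: "\<delta> > 0" "threshold_rank (\<tau> + \<delta>) (mat m n f) = threshold_rank \<tau> (mat m n f)"
    using threshold_rank_right_continuous by blast
  define T where "T = {g. frobenius_norm (mat m n (\<lambda>ij. g ij - f ij)) < \<delta>}"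
  have "T = {g. sqrt (\<Sum>i<m. \<Sum>j<n. (cmod (g (i, j) - f (i, j)))\<^sup>2) < \<delta>}"
    by (simp add: T_def frobenius_norm_def)
  then have "open T"
    by (auto intro!: open_Collect_less continuous_intros continuous_on_product_coordinates)
  moreover have "f \<in> T" using \<delta> by (simp add: T_def frobenius_norm_def)
  moreover have "T \<subseteq> ?S"
  proof
    fix g assume "g \<in> T"
    define E where "E = mat m n (\<lambda>ij. g ij - f ij)"
    have E: "E \<in> carrier_mat m n" by (simp add: E_def)
    have "l2_norm_vec (E *\<^sub>v v) \<le> \<delta> * l2_norm_vec v" if "v \<in> carrier_vec n" for v
      using l2_norm_mult_mat_vec_le_frobenius[OF E that] \<open>g \<in> T\<close>
        mult_right_mono[of "frobenius_norm E" \<delta> "l2_norm_vec v"]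
      by (simp add: T_def E_def)
    then have "threshold_rank (\<tau> + \<delta>) (mat m n f) \<le> threshold_rank \<tau> (mat m n f + E)"
      using \<delta> assms E by (intro threshold_rank_add(2)) auto
    moreover have "mat m n f + E = mat m n g" by (intro eq_matI) (auto simp: E_def)
    ultimately show "g \<in> ?S" using \<open>f \<in> ?S\<close> \<delta>(2) by simp
  qed
  ultimately show "\<exists>T. open T \<and> f \<in> T \<and> T \<subseteq> ?S" by blast
qed

text \<open>The product topology on functions from the countable set of index pairs is second countable, so
  entrywise measurability makes the function of all entries a Borel map, to which the openness
  applies.\<close>

lemma random_mat_threshold_rank_ge_sets:
  assumes X: "random_mat M m n X" and "0 \<le> \<tau>"
  shows "{\<omega> \<in> space M. k \<le> threshold_rank \<tau> (X \<omega>)} \<in> sets M"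
proof -
  \<comment> \<open>Outside the index range the entries of a matrix are unspecified, so they are replaced by 0.\<close>
  define F where "F \<omega> = (\<lambda>(i, j). if i < m \<and> j < n then X \<omega> $$ (i, j) else 0)" for \<omega>
  have "(\<lambda>\<omega>. F \<omega> ij) \<in> borel_measurable M" for ij
    using X by (cases ij; cases "fst ij < m \<and> snd ij < n") (auto simp: F_def random_mat_def)
  then have "F \<in> borel_measurable M"
    by (rule measurable_coordinatewise_then_product)
  moreover have "{f. k \<le> threshold_rank \<tau> (mat m n f)} \<in> sets borel"
    using open_threshold_rank_ge[OF \<open>0 \<le> \<tau>\<close>] by (rule borel_open)
  ultimately have "F -` {f. k \<le> threshold_rank \<tau> (mat m n f)} \<inter> space M \<in> sets M"
    by (rule measurable_sets)
  moreover have "mat m n (F \<omega>) = X \<omega>" if "\<omega> \<in> space M" for \<omega>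
    using X that by (intro eq_matI) (auto simp: F_def random_mat_def)
  then have "F -` {f. k \<le> threshold_rank \<tau> (mat m n f)} \<inter> space M
      = {\<omega> \<in> space M. k \<le> threshold_rank \<tau> (X \<omega>)}" by auto
  ultimately show ?thesis by simp
qed

text \<open>The condition ranges over uncountably many thresholds. As the threshold rank is antitone in the
  threshold, it is constant on the interval as soon as it is constant on its rational points.\<close>

lemma random_mat_threshold_rank_eq_on_interval_sets:
  assumes X: "random_mat M m n X" and "0 \<le> a"
  shows "{\<omega> \<in> space M. \<forall>\<tau>. a < \<tau> \<and> \<tau> < b \<longrightarrow> threshold_rank \<tau> (X \<omega>) = r} \<in> sets M"
proof -
  have "(\<forall>\<tau>. a < \<tau> \<and> \<tau> < b \<longrightarrow> threshold_rank \<tau> A = r) \<longleftrightarrow>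
        (\<forall>q::rat. a < of_rat q \<and> of_rat q < b \<longrightarrow> threshold_rank (of_rat q) A = r)" for A
  proof (intro iffI allI impI)
    fix \<tau> assume rats: "\<forall>q::rat. a < of_rat q \<and> of_rat q < b \<longrightarrow> threshold_rank (of_rat q) A = r"
      and \<tau>: "a < \<tau> \<and> \<tau> < b"
    obtain p q where "a < of_rat p" "of_rat p < \<tau>" "\<tau> < of_rat q" "of_rat q < b"
      using of_rat_dense[of a \<tau>] of_rat_dense[of \<tau> b] \<tau> by blast
    then show "threshold_rank \<tau> A = r"
      using rats[rule_format, of p] rats[rule_format, of q]
        threshold_rank_antimono[of "of_rat p" \<tau> A] threshold_rank_antimono[of \<tau> "of_rat q" A]
      by simp
  qed simp
  then have eq: "{\<omega> \<in> space M. \<forall>\<tau>. a < \<tau> \<and> \<tau> < b \<longrightarrow> threshold_rank \<tau> (X \<omega>) = r}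
      = {\<omega> \<in> space M. \<forall>q::rat. a < of_rat q \<and> of_rat q < b \<longrightarrow> threshold_rank (of_rat q) (X \<omega>) = r}"
    by simp
  have fixed: "{\<omega> \<in> space M. threshold_rank \<tau> (X \<omega>) = r} \<in> sets M" if "0 \<le> \<tau>" for \<tau>
  proof -
    have "{\<omega> \<in> space M. threshold_rank \<tau> (X \<omega>) = r}
        = {\<omega> \<in> space M. r \<le> threshold_rank \<tau> (X \<omega>)} - {\<omega> \<in> space M. Suc r \<le> threshold_rank \<tau> (X \<omega>)}"
      by auto
    then show ?thesis using random_mat_threshold_rank_ge_sets[OF X that] by simp
  qed
  have "{\<omega> \<in> space M. a < of_rat q \<and> of_rat q < b \<longrightarrow> threshold_rank (of_rat q) (X \<omega>) = r} \<in> sets M"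
    for q :: rat
  proof (cases "a < of_rat q \<and> of_rat q < b")
    case True
    then have "0 \<le> (of_rat q :: real)" using \<open>0 \<le> a\<close> by linarith
    from fixed[OF this] show ?thesis by (simp only: True simp_thms)
  next
    case False
    show ?thesis by (simp only: False simp_thms Collect_mem_eq sets.top)
  qed
  then show ?thesis unfolding eq by (rule sets.sets_Collect_countable_All)
qed

section \<open>Recovery of the rank with high probability\<close>

theorem theorem3p6:
  fixes M :: "'w measure"
    and r J :: nat
    and H B :: "complex mat"
    and Z Hhat :: "'w \<Rightarrow> complex mat"
    and s V t :: real
  assumes "prob_space M"
    and "r \<ge> 1" and "J \<ge> r + 1"
    and "H \<in> carrier_mat J J" and "hankel_mat H" and "vec_space.rank J H = r"
    and "s = singular_value H r" and "s > 0"
    and "B \<in> carrier_mat J J"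
    and "random_mat M J J Z"
    and "integrable M (\<lambda>\<omega>. (frobenius_norm (Z \<omega>))\<^sup>2)"
    and "prob_space.expectation M (\<lambda>\<omega>. (frobenius_norm (Z \<omega>))\<^sup>2) = V"
    and "\<And>\<omega>. \<omega> \<in> space M \<Longrightarrow> Hhat \<omega> = H + B + Z \<omega>"
    and "t > 0"
    and "spectral_norm B + t < s / 2"
  shows "prob_space.prob M {\<omega> \<in> space M.
           \<forall>\<tau>. spectral_norm B + t < \<tau> \<and> \<tau> < s - spectral_norm B - t \<longrightarrow>
             threshold_rank \<tau> (Hhat \<omega>) = r} \<ge> 1 - V / t\<^sup>2"
    (is "prob_space.prob M ?good \<ge> _")
proof -
  interpret prob_space M by fact
  note H = assms(4) and B = assms(9) and Z = assms(10) and Hhat = assms(13)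
  have Zc: "Z \<omega> \<in> carrier_mat J J" if "\<omega> \<in> space M" for \<omega>
    using Z that by (auto simp: random_mat_def)
  note B_le = l2_norm_mult_mat_vec_le_spectral[OF B]
  define large where "large = {\<omega> \<in> space M. t\<^sup>2 \<le> (frobenius_norm (Z \<omega>))\<^sup>2}"
  have large: "large \<in> events"
    unfolding large_def using borel_measurable_integrable[OF assms(11)] by measurable
  have markov: "prob large \<le> V / t\<^sup>2"
    using integral_Markov_inequality_measure[OF assms(11), of "{}" "t\<^sup>2"] assms(12) \<open>t > 0\<close>
    by (simp add: large_def)
  have "random_mat M J J Hhat"
  proof -
    have "(\<lambda>\<omega>. Hhat \<omega> $$ (i, j)) \<in> borel_measurable M" if ij: "i < J" "j < J" for i j
    proof -
      have "(\<lambda>\<omega>. (H + B) $$ (i, j) + Z \<omega> $$ (i, j)) \<in> borel_measurable M"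
        using Z ij by (auto simp: random_mat_def intro!: borel_measurable_add)
      moreover have "Hhat \<omega> $$ (i, j) = (H + B) $$ (i, j) + Z \<omega> $$ (i, j)" if "\<omega> \<in> space M" for \<omega>
        using Hhat[OF that] Zc[OF that] ij H B by simp
      ultimately show ?thesis by (simp only: cong: measurable_cong)
    qed
    then show ?thesis using Hhat Zc H B by (auto simp: random_mat_def)
  qed
  \<comment> \<open>A set that is not an event has measure 0 by convention, so the bound depends on this fact.\<close>
  then have good: "?good \<in> events"
    using B_le(1) \<open>t > 0\<close> by (intro random_mat_threshold_rank_eq_on_interval_sets) auto
  have "space M - large \<subseteq> ?good"
  proof (intro subsetI CollectI conjI allI impI)
    fix \<omega> \<tau> assume \<omega>: "\<omega> \<in> space M - large" and
      \<tau>: "spectral_norm B + t < \<tau> \<and> \<tau> < s - spectral_norm B - t"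
    have space: "\<omega> \<in> space M" using \<omega> by simp
    have Z_lt: "frobenius_norm (Z \<omega>) < t"
      using \<omega> \<open>t > 0\<close> by (auto simp: large_def not_le intro: power2_less_imp_less)
    have "l2_norm_vec ((B + Z \<omega>) *\<^sub>v v) \<le> (spectral_norm B + t) * l2_norm_vec v"
      if v: "v \<in> carrier_vec J" for v
    proof -
      have "l2_norm_vec ((B + Z \<omega>) *\<^sub>v v) \<le> l2_norm_vec (B *\<^sub>v v) + l2_norm_vec (Z \<omega> *\<^sub>v v)"
        unfolding add_mult_distrib_mat_vec[OF B Zc[OF space] v]
        using B Zc[OF space] v by (intro l2_norm_vec_triangle[of _ J]) auto
      also have "\<dots> \<le> spectral_norm B * l2_norm_vec v + frobenius_norm (Z \<omega>) * l2_norm_vec v"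
        by (intro add_mono B_le(2) l2_norm_mult_mat_vec_le_frobenius[of _ J J] v Zc space)
      also have "\<dots> \<le> (spectral_norm B + t) * l2_norm_vec v"
        unfolding distrib_right using Z_lt by (intro add_left_mono mult_right_mono) auto
      finally show ?thesis .
    qed
    then have "threshold_rank \<tau> (H + (B + Z \<omega>)) = r"
      using B Zc[OF space] assms \<tau> B_le(1)
      by (intro threshold_rank_eq_rank_of_perturbation[where \<epsilon> = "spectral_norm B + t" and m = J and n = J]) auto
    also have "H + (B + Z \<omega>) = Hhat \<omega>"
      unfolding Hhat[OF space] by (rule assoc_add_mat[OF H B Zc[OF space], symmetric])
    finally show "threshold_rank \<tau> (Hhat \<omega>) = r" .
  qed simp
  then have "prob (space M - large) \<le> prob ?good"
    by (rule finite_measure_mono) (rule good)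
  then show ?thesis using prob_compl[OF large] markov by simp
qed

end
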